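(* Let $R$ be a commutative ring with unity, let $S\subseteq R$ be a multiplicatively closed subset, and let $M$ be an ideal of $R$ such that $M\cap S=\emptyset$. Then $M$ is an $S$-maximal ideal of $R$ if and only if $R/M$ is an $\overline{S}$-field, where $\overline{S}=\{s+M\mid s\in S\}$ is a multiplicatively closed subset of $R/M$.
   Context: A multiplicatively closed subset $S$ of a commutative ring $R$ is a subset with $1\in S$, $0\notin S$, and $st\in S$ for all $s,t\in S$. For a commutative ring $A$ with multiplicatively closed subset $T$: an ideal $I$ of $A$ with $I\cap T=\emptyset$ is $T$-maximal if there exists $t\in T$ such that for every ideal $J$ of $A$ with $I\subseteq J$, either $tJ\subseteq I$ or $J\cap T\neq\emptyset$; and $A$ is a $T$-field if its zero ideal is a $T$-maximal ideal of $A$. *)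

theory Defs
  imports "HOL-Algebra.QuotRing"
begin

definition mult_closed_subset :: "'a set \<Rightarrow> ('a, 'b) ring_scheme \<Rightarrow> bool" where
  "mult_closed_subset T A \<longleftrightarrow> submonoid T A \<and> \<zero>\<^bsub>A\<^esub> \<notin> T"

text \<open>Below, \<open>A\<close> is meant to be a commutative ring and \<open>T\<close> a multiplicatively closed
  subset of it; these standing assumptions are not part of the predicates.\<close>

definition S_maximal_ideal :: "'a set \<Rightarrow> 'a set \<Rightarrow> ('a, 'b) ring_scheme \<Rightarrow> bool" where
  "S_maximal_ideal T I A \<longleftrightarrow>
     ideal I A \<and> I \<inter> T = {} \<and>
     (\<exists>t\<in>T. \<forall>J. ideal J A \<and> I \<subseteq> J \<longrightarrow> t <#\<^bsub>A\<^esub> J \<subseteq> I \<or> J \<inter> T \<noteq> {})"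

definition S_field :: "'a set \<Rightarrow> ('a, 'b) ring_scheme \<Rightarrow> bool" where
  "S_field T A \<longleftrightarrow> S_maximal_ideal T {\<zero>\<^bsub>A\<^esub>} A"

text \<open>The coset \<open>s + M\<close> is written as the right coset \<open>M +> s\<close>, the form in which
  \<^const>\<open>FactRing\<close> represents its elements.\<close>

definition quot_image :: "('a, 'b) ring_scheme \<Rightarrow> 'a set \<Rightarrow> 'a set \<Rightarrow> 'a set set" where
  "quot_image R M S = {M +>\<^bsub>R\<^esub> s | s. s \<in> S}"

end

theory Submission
  imports Defs
begin

text \<open>Write \<open>\<pi>\<close> for the projection \<open>r \<mapsto> I + r\<close>, where \<open>I\<close> is the ideal \<open>M\<close> of the theorem. By the
  correspondence theorem, \<open>J \<mapsto> \<pi>(J)\<close> maps the ideals \<open>J \<supseteq> I\<close> of \<open>R\<close> onto the ideals of the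
  quotient, and each of the two conditions on \<open>J\<close> in the definition of \<open>S\<close>-maximality passes through
  it in both directions. Since \<open>\<pi>(t) \<cdot> \<pi>(j) = \<pi>(t \<cdot> j)\<close> and \<open>I\<close> is the kernel of \<open>\<pi>\<close>, the inclusion
  \<open>tJ \<subseteq> I\<close> says precisely that \<open>\<pi>(t) \<cdot> \<pi>(J)\<close> is zero (\<open>rcos_smult_image_zero_iff\<close>); and since \<open>J\<close> is
  saturated, being a union of cosets of \<open>I\<close>, it meets \<open>S\<close> precisely when \<open>\<pi>(J)\<close> meets \<open>\<pi>(S)\<close>
  (\<open>rcos_image_Int_empty_iff\<close>). So an element \<open>t\<close> of \<open>S\<close> witnesses \<open>S\<close>-maximality of \<open>I\<close> if and only
  if \<open>\<pi>(t)\<close> witnesses \<open>\<pi>(S)\<close>-maximality of the zero ideal.\<close>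

lemma quot_image_eq_image: "quot_image R I S = (+>\<^bsub>R\<^esub>) I ` S"
  unfolding quot_image_def by blast

context ideal
begin

lemma rcos_eq_self_iff:
  assumes "x \<in> carrier R"
  shows "I +> x = I \<longleftrightarrow> x \<in> I"
  using assms a_rcos_const a_rcos_self by blast

text \<open>Two elements with the same coset differ by an element of \<open>I\<close>, so they cannot be separated by
  an ideal that contains \<open>I\<close>.\<close>

lemma rcos_mem_image_iff:
  assumes "ideal J R" "I \<subseteq> J" "x \<in> carrier R"
  shows "I +> x \<in> (+>) I ` J \<longleftrightarrow> x \<in> J"
proof
  assume "I +> x \<in> (+>) I ` J"
  then obtain j where j: "j \<in> J" "I +> x = I +> j" by blast
  from a_rcos_self[OF assms(3)] j(2) obtain i where i: "i \<in> I" "x = i \<oplus> j"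
    unfolding a_r_coset_def' by auto
  show "x \<in> J"
    using i j(1) assms(2) additive_subgroup.a_closed[OF ideal.axioms(1)[OF assms(1)]] by blast
qed blast

lemma rcos_image_Int_empty_iff:
  assumes "ideal J R" "I \<subseteq> J" "S \<subseteq> carrier R"
  shows "(+>) I ` J \<inter> (+>) I ` S = {} \<longleftrightarrow> J \<inter> S = {}"
proof -
  have "(+>) I ` J \<inter> (+>) I ` S = (+>) I ` (J \<inter> S)"
  proof (intro equalityI subsetI)
    fix X assume "X \<in> (+>) I ` J \<inter> (+>) I ` S"
    then obtain s where s: "s \<in> S" "X = I +> s" "I +> s \<in> (+>) I ` J"
      by auto
    then have "s \<in> J"
      using rcos_mem_image_iff[OF assms(1,2)] assms(3) by (simp add: subset_iff)
    with s show "X \<in> (+>) I ` (J \<inter> S)"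
      by simp
  qed auto
  then show ?thesis
    by simp
qed

lemma rcos_smult_image_zero_iff:
  assumes "J \<subseteq> carrier R" "t \<in> carrier R"
  shows "(I +> t) <#\<^bsub>R Quot I\<^esub> ((+>) I ` J) \<subseteq> {\<zero>\<^bsub>R Quot I\<^esub>} \<longleftrightarrow> t <# J \<subseteq> I"
proof -
  have "(I +> t) \<otimes>\<^bsub>R Quot I\<^esub> (I +> j) = \<zero>\<^bsub>R Quot I\<^esub> \<longleftrightarrow> t \<otimes> j \<in> I" if "j \<in> J" for j
    using that assms rcoset_mult_add[of t j] rcos_eq_self_iff[of "t \<otimes> j"]
    by (auto simp: FactRing_def)
  then show ?thesis
    unfolding l_coset_def by auto
qed

lemma quot_ideal_iff_image:
  "ideal K (R Quot I) \<longleftrightarrow> (\<exists>J. ideal J R \<and> I \<subseteq> J \<and> K = (+>) I ` J)"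
proof -
  have "K \<in> {K. ideal K (R Quot I)} \<longleftrightarrow> K \<in> (\<lambda>J. (+>) I ` J) ` {J. ideal J R \<and> I \<subseteq> J}"
    by (simp only: bij_betw_imp_surj_on[OF quot_ideal_correspondence[OF is_ideal]])
  then show ?thesis
    by (simp only: mem_Collect_eq image_iff Bex_def conj_assoc)
qed

text \<open>Disjointness from \<open>S\<close> is what keeps the zero coset \<open>I\<close> out of the image of \<open>S\<close>.\<close>

lemma mult_closed_subset_quot_image:
  assumes "mult_closed_subset S R" "I \<inter> S = {}"
  shows "mult_closed_subset (quot_image R I S) (R Quot I)"
proof -
  interpret S: submonoid S R
    using assms(1) unfolding mult_closed_subset_def by blast
  have "submonoid ((+>) I ` S) (R Quot I)"
  proof
    show "(+>) I ` S \<subseteq> carrier (R Quot I)"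
      using S.subset by (auto simp: FactRing_def A_RCOSETS_def')
    show "\<one>\<^bsub>R Quot I\<^esub> \<in> (+>) I ` S"
      using S.one_closed by (auto simp: FactRing_def)
    show "x \<otimes>\<^bsub>R Quot I\<^esub> y \<in> (+>) I ` S"
      if "x \<in> (+>) I ` S" "y \<in> (+>) I ` S" for x y
      using that S.m_closed S.subset
      by (auto simp: FactRing_def rcoset_mult_add subset_iff)
  qed
  moreover have "\<zero>\<^bsub>R Quot I\<^esub> \<notin> (+>) I ` S"
    using assms(2) S.subset rcos_eq_self_iff by (auto simp: FactRing_def)
  ultimately show ?thesis
    unfolding mult_closed_subset_def quot_image_eq_image by blast
qed

lemma S_maximal_ideal_iff_quot_S_field:
  assumes "S \<subseteq> carrier R" "I \<inter> S = {}"
  shows "S_maximal_ideal S I R \<longleftrightarrow> S_field (quot_image R I S) (R Quot I)"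
proof -
  let ?Q = "R Quot I"
  interpret Q: ring ?Q by (rule quotient_is_ring)
  have zero_disj: "{\<zero>\<^bsub>?Q\<^esub>} \<inter> (+>) I ` S = {}"
    using assms rcos_eq_self_iff by (auto simp: FactRing_def)
  have witness: "(\<forall>J. ideal J R \<and> I \<subseteq> J \<longrightarrow> t <# J \<subseteq> I \<or> J \<inter> S \<noteq> {}) \<longleftrightarrow>
      (\<forall>K. ideal K ?Q \<and> {\<zero>\<^bsub>?Q\<^esub>} \<subseteq> K \<longrightarrow>
        (I +> t) <#\<^bsub>?Q\<^esub> K \<subseteq> {\<zero>\<^bsub>?Q\<^esub>} \<or> K \<inter> (+>) I ` S \<noteq> {})"
    (is "_ \<longleftrightarrow> (\<forall>K. _ \<longrightarrow> ?P K)") if "t \<in> S" for t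
  proof -
    have transfer: "?P ((+>) I ` J) \<longleftrightarrow> t <# J \<subseteq> I \<or> J \<inter> S \<noteq> {}"
      if "ideal J R" "I \<subseteq> J" for J
    proof -
      have "J \<subseteq> carrier R" "t \<in> carrier R"
        using additive_subgroup.a_subset[OF ideal.axioms(1)[OF that(1)]] \<open>t \<in> S\<close> assms(1) by auto
      then show ?thesis
        by (simp only: rcos_image_Int_empty_iff[OF that assms(1)] rcos_smult_image_zero_iff)
    qed
    have "{\<zero>\<^bsub>?Q\<^esub>} \<subseteq> K" if "ideal K ?Q" for K
      using additive_subgroup.zero_closed[OF ideal.axioms(1)[OF that]] by blast
    then have "(\<forall>K. ideal K ?Q \<and> {\<zero>\<^bsub>?Q\<^esub>} \<subseteq> K \<longrightarrow> ?P K) \<longleftrightarrow>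
        (\<forall>J. ideal J R \<and> I \<subseteq> J \<longrightarrow> ?P ((+>) I ` J))"
      by (auto simp: quot_ideal_iff_image)
    also have "\<dots> \<longleftrightarrow> (\<forall>J. ideal J R \<and> I \<subseteq> J \<longrightarrow> t <# J \<subseteq> I \<or> J \<inter> S \<noteq> {})"
      using transfer by simp
    finally show ?thesis ..
  qed
  have "S_maximal_ideal S I R \<longleftrightarrow>
      (\<exists>t\<in>S. \<forall>J. ideal J R \<and> I \<subseteq> J \<longrightarrow> t <# J \<subseteq> I \<or> J \<inter> S \<noteq> {})"
    unfolding S_maximal_ideal_def by (simp only: is_ideal assms(2) simp_thms)
  also have "\<dots> \<longleftrightarrow> (\<exists>t\<in>S. \<forall>K. ideal K ?Q \<and> {\<zero>\<^bsub>?Q\<^esub>} \<subseteq> K \<longrightarrow>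
      (I +> t) <#\<^bsub>?Q\<^esub> K \<subseteq> {\<zero>\<^bsub>?Q\<^esub>} \<or> K \<inter> (+>) I ` S \<noteq> {})"
    by (rule bex_cong[OF refl witness])
  also have "\<dots> \<longleftrightarrow> S_field (quot_image R I S) ?Q"
    unfolding S_field_def S_maximal_ideal_def quot_image_eq_image
    by (simp only: Q.zeroideal zero_disj bex_simps simp_thms)
  finally show ?thesis .
qed

end

theorem proposition3p9:
  fixes R :: "('a, 'b) ring_scheme" and S M :: "'a set"
  assumes "cring R"
    and "mult_closed_subset S R"
    and "ideal M R"
    and "M \<inter> S = {}"
  shows "mult_closed_subset (quot_image R M S) (R Quot M) \<and>
    (S_maximal_ideal S M R \<longleftrightarrow> S_field (quot_image R M S) (R Quot M))"
proof -
  have "S \<subseteq> carrier R"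
    using assms(2) submonoid.subset unfolding mult_closed_subset_def by blast
  then show ?thesis
    using ideal.mult_closed_subset_quot_image[OF assms(3,2,4)]
      ideal.S_maximal_ideal_iff_quot_S_field[OF assms(3) _ assms(4)] by blast
qed

end
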